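(* Let $W\in\mathrm{Mat}_{1,n}(\mathbb{Z})$ be a row matrix with positive entries and let $P$ be graded by $W$. Let $\sigma$ be a module ordering on $\mathbb{T}^n\langle e_1,\dots,e_r\rangle$ and let $\overline\sigma$ be its extension by $W$. (1) If $v$ is a non-zero vector in $F$, we have $\mathrm{LT}_{\overline\sigma}(v^{\rm hom})=\mathrm{LT}_\sigma(v)$. (2) If $N$ is a graded submodule of $\overline F$ and $\mathcal G=\{V_1,V_2,\dots,V_t\}$ is a homogeneous $\overline\sigma$-Gröbner basis of $N$, then the set $\{V_1^{\rm sat},V_2^{\rm sat},\dots,V_t^{\rm sat}\}$ is a $\overline\sigma$-Gröbner basis of $N^{\rm sat}$.
   Context: $K$ is a field, $P=K[x_1,\dots,x_n]$, and $\overline P=K[y,x_1,\dots,x_n]$ is graded by $\overline W=(1\mid W)$, i.e. $\deg(y)=1$ and $\deg(x_j)$ is the $j$-th entry of $W$. $\mathbb{T}^n$ is the monoid of power products of $P$. $F=P^r$ has canonical basis $e_1,\dots,e_r$; $\delta_1,\dots,\delta_r\in\mathbb{Z}$ are fixed and $\overline F=\bigoplus_{i=1}^r\overline P(-\delta_i)$, so $\deg(te_i)=\deg(t)+\delta_i$ (for terms of $F$ and of $\overline F$). $\mathbb{T}^n\langle e_1,\dots,e_r\rangle$ is the set of terms $te_i$ of $F$. A module ordering is a total ordering on the set of terms compatible with multiplication by power products and with a monoid ordering $\tau$ on power products ($t_1>_\tau t_2$ implies $t_1e_i>t_2e_i$). The extension $\overline\sigma$ of $\sigma$ by $W$ to the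 terms of $\overline F$: $t_1e_i>_{\overline\sigma}t_2e_j$ iff $\deg_{\overline W}(t_1e_i)>\deg_{\overline W}(t_2e_j)$, or these degrees are equal and $t_1^{\rm deh}e_i>_\sigma t_2^{\rm deh}e_j$. LT is the leading term. A Gröbner basis of a module is a set of non-zero elements of it whose leading terms generate the module generated by all leading terms of its non-zero elements; it is homogeneous if its elements are. For $V\in\overline F$, $V^{\rm deh}\in F$ is obtained by setting $y=1$ (likewise for power products). For $0\ne v=\sum_jc_jt_je_{i_j}\in F$ (distinct terms, $c_j\ne0$), with $\mu=\max_j\deg_W(t_je_{i_j})$, $v^{\rm hom}=\sum_jc_j\,y^{\mu-\deg_W(t_je_{i_j})}t_je_{i_j}\in\overline F$; $0^{\rm hom}=0$. For a submodule $M\subseteq F$, $M^{\rm hom}=\langle v^{\rm hom}\mid v\in M\rangle$; for a graded submodule $N\subseteq\overline F$, $N^{\rm deh}=\{V^{\rm deh}\mid V\in N\}$ and $N^{\rm sat}=(N^{\rm deh})^{\rm hom}$. For homogeneous $U\in\overline F$, $U^{\rm sat}=(U^{\rm deh})^{\rm hom}$.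
   Formalization: The formal theorem also assumes that σ is degree compatible: deg_W(s) > deg_W(s') implies s >_σ s'. Without this both parts fail: for lex with x > z and W = (1,1), v = x − z² has LT x but v^hom = xy − z² has LT xy. *)

theory Defs
  imports "HOL-Library.Poly_Mapping" "HOL-Analysis.Cartesian_Space"
begin

(* Power products are exponent vectors, so the monoid operation is written additively.
   The variables x_1, ..., x_n are indexed by a finite type 'n; the ring with the extra
   variable y uses the index type 'n option, where None stands for y and Some j for x_j. *)
type_synonym 'x pp = "'x \<Rightarrow>\<^sub>0 nat"
type_synonym ('x, 'k) mpoly = "'x pp \<Rightarrow>\<^sub>0 'k"

(* The pair (t, i) is the term t e_i; the free module of rank r is ('x, 'k) mpoly ^ 'r. *)
type_synonym ('x, 'r) mterm = "'x pp \<times> 'r"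

interpretation pmod: module "(*s) :: 'a::comm_ring_1 \<Rightarrow> 'a ^ 'r \<Rightarrow> 'a ^ 'r"
  by unfold_locales (simp_all add: vec_eq_iff algebra_simps)

definition mterms :: "('x, 'k::zero) mpoly ^ 'r \<Rightarrow> ('x, 'r) mterm set" where
  "mterms v = {(t, i). t \<in> Poly_Mapping.keys (v $ i)}"

definition term_vec :: "('x, 'r) mterm \<Rightarrow> ('x, 'k::zero_neq_one) mpoly ^ 'r" where
  "term_vec s = axis (snd s) (Poly_Mapping.single (fst s) 1)"


text \<open>Gradings: \<open>W\<close> is the row of weights of the indeterminates, \<open>\<delta>\<close> the degrees of the
  basis vectors.\<close>

definition pp_deg :: "int ^ 'x::finite \<Rightarrow> 'x pp \<Rightarrow> int" where
  "pp_deg W t = (\<Sum>j\<in>UNIV. W $ j * int (Poly_Mapping.lookup t j))"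

definition term_deg :: "int ^ 'x::finite \<Rightarrow> int ^ 'r \<Rightarrow> ('x, 'r) mterm \<Rightarrow> int" where
  "term_deg W \<delta> s = pp_deg W (fst s) + \<delta> $ snd s"

definition ext_weights :: "int ^ 'n \<Rightarrow> int ^ ('n option)" where
  "ext_weights W = (\<chi> k. case k of None \<Rightarrow> 1 | Some j \<Rightarrow> W $ j)"

definition homogeneous ::
    "int ^ 'x::finite \<Rightarrow> int ^ 'r \<Rightarrow> ('x, 'k::zero) mpoly ^ 'r \<Rightarrow> bool" where
  "homogeneous W \<delta> v \<longleftrightarrow> (\<exists>d. \<forall>s\<in>mterms v. term_deg W \<delta> s = d)"

definition hom_component ::
    "int ^ 'x::finite \<Rightarrow> int ^ 'r \<Rightarrow> int \<Rightarrow> ('x, 'k::comm_monoid_add) mpoly ^ 'r \<Rightarrow> ('x, 'k) mpoly ^ 'r" where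
  "hom_component W \<delta> d v = (\<chi> i. \<Sum>t\<in>{t \<in> Poly_Mapping.keys (v $ i). term_deg W \<delta> (t, i) = d}.
     Poly_Mapping.single t (Poly_Mapping.lookup (v $ i) t))"

definition graded_submodule ::
    "int ^ 'x::finite \<Rightarrow> int ^ 'r \<Rightarrow> (('x, 'k::field) mpoly ^ 'r) set \<Rightarrow> bool" where
  "graded_submodule W \<delta> N \<longleftrightarrow>
     pmod.subspace N \<and> (\<forall>v\<in>N. \<forall>d. hom_component W \<delta> d v \<in> N)"


text \<open>An ordering is given by its strict part: \<open>\<sigma> s s'\<close> means that \<open>s\<close> is greater than \<open>s'\<close>.
  Orderings need not be well-orderings.\<close>

definition strict_total :: "('a \<Rightarrow> 'a \<Rightarrow> bool) \<Rightarrow> bool" where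
  "strict_total gt \<longleftrightarrow> irreflp gt \<and> transp gt \<and> totalp gt"

definition monoid_ordering :: "('x pp \<Rightarrow> 'x pp \<Rightarrow> bool) \<Rightarrow> bool" where
  "monoid_ordering \<tau> \<longleftrightarrow> strict_total \<tau> \<and> (\<forall>t t1 t2. \<tau> t1 t2 \<longrightarrow> \<tau> (t + t1) (t + t2))"

definition module_ordering :: "(('x, 'r) mterm \<Rightarrow> ('x, 'r) mterm \<Rightarrow> bool) \<Rightarrow> bool" where
  "module_ordering \<sigma> \<longleftrightarrow> strict_total \<sigma> \<and>
     (\<forall>t t1 i t2 j. \<sigma> (t1, i) (t2, j) \<longrightarrow> \<sigma> (t + t1, i) (t + t2, j)) \<and>
     (\<exists>\<tau>. monoid_ordering \<tau> \<and> (\<forall>t1 t2 i. \<tau> t1 t2 \<longrightarrow> \<sigma> (t1, i) (t2, i)))"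

(* Module orderings are not degree compatible in general. For those that are not, the leading
   term of hom W \<delta> v can involve y and hence differ from that of v: with weights 1 and
   sigma = lex, x > z, the vector x - z^2 has leading term x, but its homogenization
   x y - z^2 has leading term x y. *)
definition degree_compatible ::
    "int ^ 'x::finite \<Rightarrow> int ^ 'r \<Rightarrow> (('x, 'r) mterm \<Rightarrow> ('x, 'r) mterm \<Rightarrow> bool) \<Rightarrow> bool" where
  "degree_compatible W \<delta> \<sigma> \<longleftrightarrow>
     (\<forall>s s'. term_deg W \<delta> s > term_deg W \<delta> s' \<longrightarrow> \<sigma> s s')"

(* Meaningful for non-zero v and total orderings only. *)
definition LT ::
    "(('x, 'r) mterm \<Rightarrow> ('x, 'r) mterm \<Rightarrow> bool) \<Rightarrow> ('x, 'k::zero) mpoly ^ 'r \<Rightarrow> ('x, 'r) mterm" where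
  "LT \<sigma> v = (THE s. s \<in> mterms v \<and> (\<forall>s'\<in>mterms v. s' \<noteq> s \<longrightarrow> \<sigma> s s'))"

definition groebner_basis ::
    "(('x, 'r) mterm \<Rightarrow> ('x, 'r) mterm \<Rightarrow> bool) \<Rightarrow> (('x, 'k::field) mpoly ^ 'r) set \<Rightarrow>
     (('x, 'k) mpoly ^ 'r) set \<Rightarrow> bool" where
  "groebner_basis \<sigma> M G \<longleftrightarrow> G \<subseteq> M - {0} \<and>
     pmod.span ((\<lambda>v. term_vec (LT \<sigma> v) :: ('x, 'k) mpoly ^ 'r) ` G) =
     pmod.span ((\<lambda>v. term_vec (LT \<sigma> v) :: ('x, 'k) mpoly ^ 'r) ` (M - {0}))"


(* y_pp a t is the power product y^a t. *)
definition y_pp :: "nat \<Rightarrow> 'n::finite pp \<Rightarrow> 'n option pp" where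
  "y_pp a t = Poly_Mapping.single None a +
     (\<Sum>j\<in>UNIV. Poly_Mapping.single (Some j) (Poly_Mapping.lookup t j))"

definition incl_term :: "('n::finite, 'r) mterm \<Rightarrow> ('n option, 'r) mterm" where
  "incl_term s = (y_pp 0 (fst s), snd s)"

definition deh_pp :: "'n option pp \<Rightarrow> 'n pp" where
  "deh_pp T = Poly_Mapping.map_key Some T"

definition deh :: "('n option, 'k::comm_monoid_add) mpoly ^ 'r \<Rightarrow> ('n, 'k) mpoly ^ 'r" where
  "deh V = (\<chi> i. \<Sum>T\<in>Poly_Mapping.keys (V $ i). Poly_Mapping.single (deh_pp T) (Poly_Mapping.lookup (V $ i) T))"

(* For v = 0 all sums are empty, so the value is 0 and the maximum is irrelevant.
   For a term of v the exponent is non-negative, so nat does not truncate. *)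
definition hom ::
    "int ^ 'n::finite \<Rightarrow> int ^ 'r \<Rightarrow> ('n, 'k::comm_monoid_add) mpoly ^ 'r \<Rightarrow> ('n option, 'k) mpoly ^ 'r" where
  "hom W \<delta> v = (let \<mu> = Max (term_deg W \<delta> ` mterms v) in
     \<chi> i. \<Sum>t\<in>Poly_Mapping.keys (v $ i).
       Poly_Mapping.single (y_pp (nat (\<mu> - term_deg W \<delta> (t, i))) t) (Poly_Mapping.lookup (v $ i) t))"

definition hom_module ::
    "int ^ 'n::finite \<Rightarrow> int ^ 'r \<Rightarrow> (('n, 'k::field) mpoly ^ 'r) set \<Rightarrow> (('n option, 'k) mpoly ^ 'r) set" where
  "hom_module W \<delta> M = pmod.span (hom W \<delta> ` M)"

definition sat ::
    "int ^ 'n::finite \<Rightarrow> int ^ 'r \<Rightarrow> ('n option, 'k::comm_monoid_add) mpoly ^ 'r \<Rightarrow> ('n option, 'k) mpoly ^ 'r" where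
  "sat W \<delta> U = hom W \<delta> (deh U)"

definition sat_module ::
    "int ^ 'n::finite \<Rightarrow> int ^ 'r \<Rightarrow> (('n option, 'k::field) mpoly ^ 'r) set \<Rightarrow> (('n option, 'k) mpoly ^ 'r) set" where
  "sat_module W \<delta> N = hom_module W \<delta> (deh ` N)"

definition ext_ordering ::
    "int ^ 'n::finite \<Rightarrow> int ^ 'r \<Rightarrow> (('n, 'r) mterm \<Rightarrow> ('n, 'r) mterm \<Rightarrow> bool) \<Rightarrow>
     ('n option, 'r) mterm \<Rightarrow> ('n option, 'r) mterm \<Rightarrow> bool" where
  "ext_ordering W \<delta> \<sigma> S S' \<longleftrightarrow>
     term_deg (ext_weights W) \<delta> S > term_deg (ext_weights W) \<delta> S' \<or>
     (term_deg (ext_weights W) \<delta> S = term_deg (ext_weights W) \<delta> S' \<and>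
      \<sigma> (deh_pp (fst S), snd S) (deh_pp (fst S'), snd S'))"

end

theory Submission
  imports Defs
begin

text \<open>
  Why part (1) holds: all terms of \<open>hom W \<delta> v\<close> have the same degree, so the extended ordering
  compares them as \<open>\<sigma>\<close> compares the terms of \<open>v\<close>. The leading term of \<open>hom W \<delta> v\<close> is therefore
  \<open>y\<^sup>a\<close> times the leading term of \<open>v\<close>, and \<open>a = 0\<close> because a degree compatible \<open>\<sigma>\<close> puts a term of
  maximal degree first (\<open>LT_hom\<close>).

  Part (2) rests on the inclusion of the saturation \<open>sat_module W \<delta> N\<close> in
  \<open>{U. y\<^sup>m U \<in> N for some m}\<close> (\<open>sat_module_y_power\<close>). The latter is a submodule, so it is enough
  to look at a generator \<open>hom W \<delta> (deh V)\<close> with \<open>V \<in> N\<close>. Homogenizing \<open>deh V\<close> to a sufficiently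
  large degree \<open>D\<close> yields \<open>y\<^sup>m hom W \<delta> (deh V)\<close> on the one hand, and \<open>\<Sum>\<^sub>d y\<^bsup>D - d\<^esup> V\<^sub>d\<close> on the
  other, where \<open>V\<^sub>d\<close> are the homogeneous components of \<open>V\<close>; since \<open>N\<close> is graded, the sum is in \<open>N\<close>.

  Now let \<open>U \<noteq> 0\<close> be in the saturation, with \<open>y\<^sup>m U \<in> N\<close>. The leading term of \<open>y\<^sup>m U\<close> is \<open>y\<^sup>m\<close>
  times that of \<open>U\<close>, and it is a multiple of the leading term of some \<open>g \<in> G\<close>. As \<open>g\<close> is
  homogeneous, the leading term of \<open>deh g\<close> is that of \<open>g\<close> with \<open>y\<close> removed (\<open>LT_deh\<close>), and by
  part (1) so is the leading term of \<open>sat W \<delta> g\<close>. A term free of \<open>y\<close> that divides \<open>y\<^sup>m\<close> times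
  the leading term of \<open>U\<close> divides the leading term of \<open>U\<close> itself. Divisibility of leading terms
  is all that a Groebner basis asks for (\<open>groebner_basis_iff\<close>).
\<close>


section \<open>Power products with the extra indeterminate\<close>

lemma lookup_y_pp [simp]:
  "Poly_Mapping.lookup (y_pp a t) None = a"
  "Poly_Mapping.lookup (y_pp a t) (Some j) = Poly_Mapping.lookup t j"
  by (simp_all add: y_pp_def lookup_add lookup_sum lookup_single when_def)

lemma lookup_deh_pp [simp]: "Poly_Mapping.lookup (deh_pp T) j = Poly_Mapping.lookup T (Some j)"
  by (simp add: deh_pp_def map_key.rep_eq)

lemma pp_option_eqI:
  fixes S T :: "'n option pp"
  assumes "Poly_Mapping.lookup S None = Poly_Mapping.lookup T None" and "deh_pp S = deh_pp T"
  shows "S = T"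
proof (rule poly_mapping_eqI)
  fix k
  show "Poly_Mapping.lookup S k = Poly_Mapping.lookup T k"
    using assms(1) arg_cong[OF assms(2), of "\<lambda>t. Poly_Mapping.lookup t (the k)"]
    by (cases k) simp_all
qed

lemma deh_pp_y_pp [simp]: "deh_pp (y_pp a t) = t"
  by (rule poly_mapping_eqI) simp

lemma deh_pp_plus: "deh_pp (S + T) = deh_pp S + deh_pp T"
  by (rule poly_mapping_eqI) (simp add: lookup_add)

lemma deh_pp_single_None [simp]: "deh_pp (Poly_Mapping.single None m) = 0"
  by (rule poly_mapping_eqI) (simp add: lookup_single)

lemma pp_deg_ext_weights:
  fixes W :: "int ^ 'n::finite"
  shows "pp_deg (ext_weights W) T = int (Poly_Mapping.lookup T None) + pp_deg W (deh_pp T)"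
  by (simp add: pp_deg_def ext_weights_def UNIV_option_conv sum.reindex)

lemma term_deg_ext_weights:
  fixes W :: "int ^ 'n::finite"
  shows "term_deg (ext_weights W) \<delta> S =
    int (Poly_Mapping.lookup (fst S) None) + term_deg W \<delta> (deh_pp (fst S), snd S)"
  by (simp add: term_deg_def pp_deg_ext_weights)

lemma strict_totalD:
  assumes "strict_total gt"
  shows "\<not> gt a a" and "gt a b \<Longrightarrow> gt b c \<Longrightarrow> gt a c" and "a \<noteq> b \<Longrightarrow> gt a b \<or> gt b a"
  using assms unfolding strict_total_def
  by (blast dest: irreflpD transpD totalpD)+

text \<open>Terms of equal degree with the same dehomogenization are equal, since the degree then
  determines the exponent of \<open>y\<close>, whose weight is not zero.\<close>

lemma strict_total_ext_ordering:
  fixes W :: "int ^ 'n::finite"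
  assumes "strict_total \<sigma>"
  shows "strict_total (ext_ordering W \<delta> \<sigma>)"
proof -
  have irr: "\<And>s. \<not> \<sigma> s s" and tr: "\<And>a b c. \<sigma> a b \<Longrightarrow> \<sigma> b c \<Longrightarrow> \<sigma> a c"
    and tot: "\<And>a b. a \<noteq> b \<Longrightarrow> \<sigma> a b \<or> \<sigma> b a"
    using strict_totalD[OF assms] by blast+
  have "ext_ordering W \<delta> \<sigma> S T \<or> ext_ordering W \<delta> \<sigma> T S" if "S \<noteq> T" for S T
  proof (rule ccontr)
    assume neither: "\<not> ?thesis"
    then have deg: "term_deg (ext_weights W) \<delta> S = term_deg (ext_weights W) \<delta> T"
      and deh: "(deh_pp (fst S), snd S) = (deh_pp (fst T), snd T)"
      using tot by (force simp: ext_ordering_def)+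
    then have "fst S = fst T"
      by (intro pp_option_eqI) (simp_all add: term_deg_ext_weights)
    with deh that show False by (simp add: prod_eq_iff)
  qed
  moreover have "\<not> ext_ordering W \<delta> \<sigma> S S" for S
    by (simp add: ext_ordering_def irr)
  moreover have "ext_ordering W \<delta> \<sigma> S U"
    if "ext_ordering W \<delta> \<sigma> S T" "ext_ordering W \<delta> \<sigma> T U" for S T U
    using that tr by (auto simp: ext_ordering_def)
  ultimately show ?thesis
    unfolding strict_total_def by (auto simp: irreflp_def totalp_on_def intro!: transpI)
qed


section \<open>Moving the terms of a vector\<close>

text \<open>Homogenization, dehomogenization and multiplication by a power of \<open>y\<close> all replace each term
  by another one and keep its coefficient, where coefficients are added up if terms collide.
  Treating them as instances of one operation gives their compositions and their effect on
  leading terms at once.\<close>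

definition relabel :: "('a \<Rightarrow> 'b) \<Rightarrow> ('a \<Rightarrow>\<^sub>0 'k::comm_monoid_add) \<Rightarrow> 'b \<Rightarrow>\<^sub>0 'k" where
  "relabel f p = (\<Sum>t\<in>Poly_Mapping.keys p. Poly_Mapping.single (f t) (Poly_Mapping.lookup p t))"

lemma relabel_superset:
  assumes "finite A" and "Poly_Mapping.keys p \<subseteq> A"
  shows "relabel f p = (\<Sum>t\<in>A. Poly_Mapping.single (f t) (Poly_Mapping.lookup p t))"
  unfolding relabel_def using assms
  by (intro sum.mono_neutral_left) (auto simp: in_keys_iff)

lemma relabel_zero [simp]: "relabel f 0 = 0"
  by (simp add: relabel_def)

lemma relabel_single [simp]: "relabel f (Poly_Mapping.single t c) = Poly_Mapping.single (f t) c"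
  by (simp add: relabel_def)

lemma relabel_add: "relabel f (p + q) = relabel f p + relabel f q"
proof -
  let ?A = "Poly_Mapping.keys p \<union> Poly_Mapping.keys q"
  have "relabel f (p + q) = (\<Sum>t\<in>?A. Poly_Mapping.single (f t) (Poly_Mapping.lookup (p + q) t))"
    by (rule relabel_superset) (auto simp: keys_add)
  also have "\<dots> = relabel f p + relabel f q"
    by (simp add: relabel_superset[of ?A] lookup_add single_add sum.distrib)
  finally show ?thesis .
qed

lemma relabel_sum: "relabel f (sum g A) = (\<Sum>a\<in>A. relabel f (g a))"
  by (induction A rule: infinite_finite_induct) (simp_all add: relabel_add)

lemma relabel_relabel: "relabel g (relabel f p) = relabel (\<lambda>t. g (f t)) p"
  unfolding relabel_def[of f p] relabel_sum relabel_single by (simp add: relabel_def)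

lemma lookup_relabel:
  assumes "inj_on f (Poly_Mapping.keys p)" and "t \<in> Poly_Mapping.keys p"
  shows "Poly_Mapping.lookup (relabel f p) (f t) = Poly_Mapping.lookup p t"
proof -
  have "Poly_Mapping.lookup (relabel f p) (f t) =
      (\<Sum>s\<in>Poly_Mapping.keys p. if s = t then Poly_Mapping.lookup p s else 0)"
    unfolding relabel_def lookup_sum lookup_single when_def
    using assms by (intro sum.cong) (auto dest: inj_onD)
  also have "\<dots> = Poly_Mapping.lookup p t"
    using assms by simp
  finally show ?thesis .
qed

lemma keys_relabel:
  assumes "inj_on f (Poly_Mapping.keys p)"
  shows "Poly_Mapping.keys (relabel f p) = f ` Poly_Mapping.keys p"
proof
  show "Poly_Mapping.keys (relabel f p) \<subseteq> f ` Poly_Mapping.keys p"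
    unfolding relabel_def by (rule order_trans[OF keys_sum]) (auto split: if_splits)
  show "f ` Poly_Mapping.keys p \<subseteq> Poly_Mapping.keys (relabel f p)"
    using lookup_relabel[OF assms] by (auto simp: in_keys_iff)
qed

lemma relabel_id: "relabel (\<lambda>t. t) p = p"
proof (rule poly_mapping_eqI)
  fix t
  show "Poly_Mapping.lookup (relabel (\<lambda>t. t) p) t = Poly_Mapping.lookup p t"
  proof (cases "t \<in> Poly_Mapping.keys p")
    case True
    then show ?thesis using lookup_relabel[of "\<lambda>t. t" p t] by simp
  next
    case False
    moreover have "t \<notin> Poly_Mapping.keys (relabel (\<lambda>t. t) p)"
      using False by (simp add: keys_relabel)
    ultimately show ?thesis by (simp add: in_keys_iff)
  qed
qed

text \<open>The new power product may depend on the basis vector, as the exponent of \<open>y\<close> in a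
  homogenization does, but the basis vector itself is kept.\<close>

definition relabel_vec ::
    "(('a, 'r) mterm \<Rightarrow> 'b pp) \<Rightarrow> ('a, 'k::comm_monoid_add) mpoly ^ 'r \<Rightarrow> ('b, 'k) mpoly ^ 'r" where
  "relabel_vec f v = (\<chi> i. relabel (\<lambda>t. f (t, i)) (v $ i))"

lemma mterms_finite [simp]: "finite (mterms (v :: ('a, 'k::zero) mpoly ^ 'r::finite))"
proof -
  have "mterms v = (\<Union>i. (\<lambda>t. (t, i)) ` Poly_Mapping.keys (v $ i))"
    by (auto simp: mterms_def)
  then show ?thesis by simp
qed

lemma mterms_empty_iff [simp]: "mterms v = {} \<longleftrightarrow> v = (0 :: ('a, 'k::zero) mpoly ^ 'r)"
proof
  assume "mterms v = {}"
  then have "Poly_Mapping.lookup (v $ i) t = 0" for i t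
    by (auto simp: mterms_def in_keys_iff)
  then show "v = 0" by (auto simp: vec_eq_iff intro: poly_mapping_eqI)
qed (simp add: mterms_def)

lemma relabel_vec_relabel_vec:
  "relabel_vec g (relabel_vec f v) = relabel_vec (\<lambda>s. g (f s, snd s)) v"
  by (simp add: relabel_vec_def relabel_relabel)

lemma relabel_vec_cong:
  assumes "\<And>s. s \<in> mterms v \<Longrightarrow> f s = g s"
  shows "relabel_vec f v = relabel_vec g v"
  using assms by (auto simp: relabel_vec_def vec_eq_iff relabel_def mterms_def intro!: sum.cong)

lemma relabel_vec_zero [simp]: "relabel_vec f 0 = 0"
  by (simp add: relabel_vec_def vec_eq_iff)

lemma mterms_relabel_vec:
  assumes "inj_on (\<lambda>s. (f s, snd s)) (mterms v)"
  shows "mterms (relabel_vec f v) = (\<lambda>s. (f s, snd s)) ` mterms v"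
proof -
  have "inj_on (\<lambda>t. f (t, i)) (Poly_Mapping.keys (v $ i))" for i
    using assms by (auto simp: inj_on_def mterms_def)
  then show ?thesis
    by (force simp: mterms_def relabel_vec_def keys_relabel)
qed

lemma LT_eqI:
  assumes "strict_total gt" and "s \<in> mterms v" and "\<And>s'. s' \<in> mterms v \<Longrightarrow> s' \<noteq> s \<Longrightarrow> gt s s'"
  shows "LT gt v = s"
  unfolding LT_def
proof (rule the_equality)
  fix u assume u: "u \<in> mterms v \<and> (\<forall>s'\<in>mterms v. s' \<noteq> u \<longrightarrow> gt u s')"
  show "u = s"
  proof (rule ccontr)
    assume "u \<noteq> s"
    then have "gt u s" "gt s u" using u assms by auto
    then show False using strict_totalD[OF assms(1)] by blast
  qed
qed (use assms in auto)

lemma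
  fixes v :: "('a, 'k::zero) mpoly ^ 'r::finite"
  assumes "strict_total gt" and "v \<noteq> 0"
  shows LT_in_mterms: "LT gt v \<in> mterms v"
    and LT_greatest: "\<And>s. s \<in> mterms v \<Longrightarrow> s \<noteq> LT gt v \<Longrightarrow> gt (LT gt v) s"
proof -
  have "\<exists>m\<in>A. \<forall>s\<in>A. s \<noteq> m \<longrightarrow> gt m s" if "finite A" "A \<noteq> {}" for A
    using that
  proof (induction rule: finite_ne_induct)
    case (insert x A)
    then obtain m where m: "m \<in> A" "\<And>s. s \<in> A \<Longrightarrow> s \<noteq> m \<Longrightarrow> gt m s" by blast
    have "x \<noteq> m" using m insert by auto
    then consider "gt m x" | "gt x m"
      using strict_totalD(3)[OF assms(1)] by blast
    then show ?case
    proof cases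
      case 1
      then show ?thesis using m by auto
    next
      case 2
      have "gt x s" if "s \<in> A" for s
        using 2 m(2)[OF that] strict_totalD(2)[OF assms(1)] by (cases "s = m") blast+
      then show ?thesis by auto
    qed
  qed auto
  from this[of "mterms v"] obtain m where
    m: "m \<in> mterms v" "\<And>s. s \<in> mterms v \<Longrightarrow> s \<noteq> m \<Longrightarrow> gt m s"
    using assms(2) by auto
  then have "LT gt v = m" by (intro LT_eqI assms(1))
  with m show "LT gt v \<in> mterms v" "\<And>s. s \<in> mterms v \<Longrightarrow> s \<noteq> LT gt v \<Longrightarrow> gt (LT gt v) s"
    by auto
qed

text \<open>A map that preserves the strict order on the terms of \<open>v\<close> is injective on them, because the
  order is total. So no terms collide or cancel, and the greatest term goes to the greatest one.\<close>

lemma LT_relabel_vec: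
  fixes v :: "('a, 'k::comm_monoid_add) mpoly ^ 'r::finite"
  assumes gt: "strict_total gt" and gt': "strict_total gt'" and v: "v \<noteq> 0"
    and mono: "\<And>s s'. s \<in> mterms v \<Longrightarrow> s' \<in> mterms v \<Longrightarrow> gt s s' \<Longrightarrow> gt' (f s, snd s) (f s', snd s')"
  shows "relabel_vec f v \<noteq> 0"
    and "LT gt' (relabel_vec f v) = (f (LT gt v), snd (LT gt v))"
proof -
  have "inj_on (\<lambda>s. (f s, snd s)) (mterms v)"
  proof (rule inj_onI, rule ccontr)
    fix s s' assume s: "s \<in> mterms v" "s' \<in> mterms v" "(f s, snd s) = (f s', snd s')" "s \<noteq> s'"
    then have "gt' (f s, snd s) (f s, snd s)"
      using mono[of s s'] mono[of s' s] strict_totalD(3)[OF gt s(4)] by auto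
    then show False using strict_totalD(1)[OF gt'] by blast
  qed
  then have terms: "mterms (relabel_vec f v) = (\<lambda>s. (f s, snd s)) ` mterms v"
    by (rule mterms_relabel_vec)
  then show "relabel_vec f v \<noteq> 0"
    using v by (metis image_is_empty mterms_empty_iff)
  show "LT gt' (relabel_vec f v) = (f (LT gt v), snd (LT gt v))"
  proof (rule LT_eqI[OF gt'])
    show "(f (LT gt v), snd (LT gt v)) \<in> mterms (relabel_vec f v)"
      using LT_in_mterms[OF gt v] by (simp add: terms)
  next
    fix s' assume "s' \<in> mterms (relabel_vec f v)" and neq: "s' \<noteq> (f (LT gt v), snd (LT gt v))"
    then obtain s where s: "s \<in> mterms v" "s' = (f s, snd s)" by (auto simp: terms)
    with neq have "s \<noteq> LT gt v" by blast
    then show "gt' (f (LT gt v), snd (LT gt v)) s'"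
      unfolding s(2) by (intro mono LT_in_mterms[OF gt v] LT_greatest[OF gt v] s(1))
  qed
qed


section \<open>Homogenization, dehomogenization and powers of the extra indeterminate\<close>

definition y_power :: "nat \<Rightarrow> ('n option, 'k::comm_ring_1) mpoly" where
  "y_power m = Poly_Mapping.single (Poly_Mapping.single None m) 1"

lemma y_power_add: "y_power (a + b) = y_power a * y_power b"
  by (simp add: y_power_def mult_single single_add)

lemma y_power_mult_vec:
  "y_power m *s V = relabel_vec (\<lambda>S. Poly_Mapping.single None m + fst S) V"
proof -
  have "y_power m * p = relabel ((+) (Poly_Mapping.single None m)) p" for p :: "('a option, 'b) mpoly"
  proof -
    have "y_power m * p = y_power m * relabel (\<lambda>t. t) p" by (simp add: relabel_id)
    then show ?thesis by (simp add: relabel_def y_power_def sum_distrib_left mult_single)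
  qed
  then show ?thesis by (simp add: vec_eq_iff relabel_vec_def)
qed

lemma deh_eq_relabel_vec: "deh V = relabel_vec (\<lambda>S. deh_pp (fst S)) V"
  by (simp add: deh_def relabel_vec_def relabel_def)

text \<open>In contrast to \<open>hom\<close>, whose target degree depends on its argument, homogenization to a
  fixed degree \<open>D\<close> is additive.\<close>

definition homogenize_to ::
    "int ^ 'n::finite \<Rightarrow> int ^ 'r \<Rightarrow> int \<Rightarrow> ('n, 'k::comm_monoid_add) mpoly ^ 'r \<Rightarrow> ('n option, 'k) mpoly ^ 'r"
  where "homogenize_to W \<delta> D = relabel_vec (\<lambda>s. y_pp (nat (D - term_deg W \<delta> s)) (fst s))"

lemma hom_eq_homogenize_to: "hom W \<delta> v = homogenize_to W \<delta> (Max (term_deg W \<delta> ` mterms v)) v"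
  by (simp add: hom_def homogenize_to_def relabel_vec_def relabel_def)

lemma homogenize_to_eq_y_power_hom:
  fixes v :: "('n::finite, 'k::comm_ring_1) mpoly ^ 'r::finite"
  assumes "\<And>s. s \<in> mterms v \<Longrightarrow> term_deg W \<delta> s \<le> D"
  shows "\<exists>m. homogenize_to W \<delta> D v = y_power m *s hom W \<delta> v"
proof (cases "v = 0")
  case True
  then show ?thesis by (simp add: homogenize_to_def hom_eq_homogenize_to)
next
  case False
  let ?\<mu> = "Max (term_deg W \<delta> ` mterms v)"
  have \<mu>: "\<And>s. s \<in> mterms v \<Longrightarrow> term_deg W \<delta> s \<le> ?\<mu>" and "?\<mu> \<le> D"
    using False assms by auto
  have "y_pp (nat (D - d)) t = Poly_Mapping.single None (nat (D - ?\<mu>)) + y_pp (nat (?\<mu> - d)) t"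
    if "d \<le> ?\<mu>" for d and t :: "'n pp"
    using that \<open>?\<mu> \<le> D\<close>
    by (intro pp_option_eqI) (simp_all add: deh_pp_plus lookup_add)
  then have "homogenize_to W \<delta> D v = y_power (nat (D - ?\<mu>)) *s hom W \<delta> v"
    unfolding hom_eq_homogenize_to homogenize_to_def y_power_mult_vec relabel_vec_relabel_vec
    by (intro relabel_vec_cong) (simp add: \<mu>)
  then show ?thesis ..
qed

text \<open>For a term \<open>S\<close> of degree \<open>d \<le> D\<close>, setting \<open>y = 1\<close> and homogenizing to degree \<open>D\<close> results
  in \<open>y\<^bsup>D - d\<^esup> S\<close>: only the exponent of \<open>y\<close> changes, and the degree determines it. Grouping the
  terms by degree gives the formula, whatever cancels in \<open>deh V\<close>.\<close>

lemma homogenize_to_deh: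
  fixes V :: "('n::finite option, 'k::comm_ring_1) mpoly ^ 'r::finite"
  assumes D: "\<And>S. S \<in> mterms V \<Longrightarrow> term_deg (ext_weights W) \<delta> S \<le> D"
  shows "homogenize_to W \<delta> D (deh V) =
    (\<Sum>d\<in>term_deg (ext_weights W) \<delta> ` mterms V.
       y_power (nat (D - d)) *s hom_component (ext_weights W) \<delta> d V)"
proof -
  let ?deg = "term_deg (ext_weights W) \<delta>"
  have "y_pp (nat (D - term_deg W \<delta> (deh_pp (fst S), snd S))) (deh_pp (fst S)) =
      Poly_Mapping.single None (nat (D - ?deg S)) + fst S" if "S \<in> mterms V" for S
    using D[OF that]
    by (intro pp_option_eqI) (simp_all add: deh_pp_plus lookup_add term_deg_ext_weights)
  then have "homogenize_to W \<delta> D (deh V) =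
      relabel_vec (\<lambda>S. Poly_Mapping.single None (nat (D - ?deg S)) + fst S) V"
    unfolding homogenize_to_def deh_eq_relabel_vec relabel_vec_relabel_vec
    by (intro relabel_vec_cong) simp
  also have "\<dots> = (\<Sum>d\<in>?deg ` mterms V. y_power (nat (D - d)) *s hom_component (ext_weights W) \<delta> d V)"
  proof -
    have "(\<Sum>d\<in>?deg ` mterms V. y_power (nat (D - d)) * hom_component (ext_weights W) \<delta> d V $ i) =
        relabel (\<lambda>T. Poly_Mapping.single None (nat (D - ?deg (T, i))) + T) (V $ i)" for i
    proof -
      let ?f = "\<lambda>T. Poly_Mapping.single (Poly_Mapping.single None (nat (D - ?deg (T, i))) + T)
        (Poly_Mapping.lookup (V $ i) T)"
      have "(\<Sum>d\<in>?deg ` mterms V. y_power (nat (D - d)) * hom_component (ext_weights W) \<delta> d V $ i) =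
          (\<Sum>d\<in>?deg ` mterms V. \<Sum>T\<in>{T \<in> Poly_Mapping.keys (V $ i). ?deg (T, i) = d}. ?f T)"
        by (simp add: hom_component_def y_power_def sum_distrib_left mult_single)
      also have "\<dots> = (\<Sum>T\<in>Poly_Mapping.keys (V $ i). ?f T)"
        by (rule sum.group) (simp, simp, force simp: mterms_def)
      finally show ?thesis by (simp add: relabel_def)
    qed
    then show ?thesis by (simp add: vec_eq_iff relabel_vec_def)
  qed
  finally show ?thesis .
qed

text \<open>The saturation only adds vectors that a power of \<open>y\<close> carries back into \<open>N\<close>. This makes the
  Groebner basis of \<open>N\<close> applicable to them.\<close>

lemma sat_module_y_power:
  fixes W :: "int ^ 'n::finite" and \<delta> :: "int ^ 'r::finite"
    and N :: "(('n option, 'k::field) mpoly ^ 'r) set"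
  assumes N: "graded_submodule (ext_weights W) \<delta> N" and U: "U \<in> sat_module W \<delta> N"
  shows "\<exists>m. y_power m *s U \<in> N"
proof -
  have sub: "pmod.subspace N" and comp: "\<And>V d. V \<in> N \<Longrightarrow> hom_component (ext_weights W) \<delta> d V \<in> N"
    using N by (auto simp: graded_submodule_def)
  have "pmod.span (hom W \<delta> ` deh ` N) \<subseteq> {U. \<exists>m. y_power m *s U \<in> N}"
  proof (rule pmod.span_minimal)
    show "pmod.subspace {U. \<exists>m. y_power m *s U \<in> N}"
    proof (rule pmod.subspaceI, safe)
      show "\<exists>m. y_power m *s 0 \<in> N"
        using pmod.subspace_0[OF sub] by simp
    next
      fix U V a b assume U: "y_power a *s U \<in> N" and V: "y_power b *s V \<in> N"
      have "y_power b *s (y_power a *s U) + y_power a *s (y_power b *s V) \<in> N"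
        by (rule pmod.subspace_add[OF sub pmod.subspace_scale[OF sub U] pmod.subspace_scale[OF sub V]])
      then have "y_power (a + b) *s (U + V) \<in> N"
        by (simp add: y_power_add vector_add_ldistrib mult.commute)
      then show "\<exists>m. y_power m *s (U + V) \<in> N" ..
    next
      fix p U a assume "y_power a *s U \<in> N"
      then have "p *s (y_power a *s U) \<in> N" by (rule pmod.subspace_scale[OF sub])
      then have "y_power a *s (p *s U) \<in> N" by (simp add: mult.commute)
      then show "\<exists>m. y_power m *s (p *s U) \<in> N" ..
    qed
  next
    show "hom W \<delta> ` deh ` N \<subseteq> {U. \<exists>m. y_power m *s U \<in> N}"
    proof safe
      fix V assume V: "V \<in> N"
      (* An upper bound for the degrees in V and in deh V; the 0 makes the maximum exist for V = 0. *)
      define D where "D = Max (insert 0 (term_deg (ext_weights W) \<delta> ` mterms V \<union>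
        term_deg W \<delta> ` mterms (deh V)))"
      have D: "\<And>S. S \<in> mterms V \<Longrightarrow> term_deg (ext_weights W) \<delta> S \<le> D"
        "\<And>s. s \<in> mterms (deh V) \<Longrightarrow> term_deg W \<delta> s \<le> D"
        by (auto simp: D_def intro!: Max_ge)
      have "homogenize_to W \<delta> D (deh V) \<in> N"
        by (subst homogenize_to_deh, erule D(1))
          (intro pmod.subspace_sum[OF sub] pmod.subspace_scale[OF sub] comp V)
      with homogenize_to_eq_y_power_hom[OF D(2)] show "\<exists>m. y_power m *s hom W \<delta> (deh V) \<in> N"
        by metis
    qed
  qed
  with U show ?thesis by (auto simp: sat_module_def hom_module_def)
qed


section \<open>Leading terms\<close>

text \<open>All terms of \<open>hom W \<delta> v\<close> have the same degree, so that only \<open>\<sigma>\<close> decides between them.\<close>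

lemma
  fixes v :: "('n::finite, 'k::comm_monoid_add) mpoly ^ 'r::finite"
  assumes tot: "strict_total \<sigma>" and compat: "degree_compatible W \<delta> \<sigma>" and v: "v \<noteq> 0"
  shows hom_nonzero: "hom W \<delta> v \<noteq> 0"
    and LT_hom: "LT (ext_ordering W \<delta> \<sigma>) (hom W \<delta> v) = incl_term (LT \<sigma> v)"
proof -
  let ?\<mu> = "Max (term_deg W \<delta> ` mterms v)"
  let ?f = "\<lambda>s. y_pp (nat (?\<mu> - term_deg W \<delta> s)) (fst s)"
  have \<mu>: "\<And>s. s \<in> mterms v \<Longrightarrow> term_deg W \<delta> s \<le> ?\<mu>" by auto
  have mono: "ext_ordering W \<delta> \<sigma> (?f s, snd s) (?f s', snd s')"
    if "s \<in> mterms v" "s' \<in> mterms v" "\<sigma> s s'" for s s'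
    using that \<mu> by (simp add: ext_ordering_def term_deg_ext_weights)
  note LT_rel = LT_relabel_vec[OF tot strict_total_ext_ordering[OF tot] v mono]
  show "hom W \<delta> v \<noteq> 0"
    unfolding hom_eq_homogenize_to homogenize_to_def by (rule LT_rel(1))
  \<comment> \<open>By degree compatibility the leading term has maximal degree, so its exponent of \<open>y\<close> is zero.\<close>
  have "term_deg W \<delta> s \<le> term_deg W \<delta> (LT \<sigma> v)" if "s \<in> mterms v" for s
  proof (rule ccontr)
    assume "\<not> ?thesis"
    then have "\<sigma> s (LT \<sigma> v)" and "s \<noteq> LT \<sigma> v"
      using compat unfolding degree_compatible_def by (metis not_le, blast)
    with LT_greatest[OF tot v that] show False
      using strict_totalD[OF tot] by blast
  qed
  then have "?\<mu> = term_deg W \<delta> (LT \<sigma> v)"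
    using LT_in_mterms[OF tot v] by (intro Max_eqI) auto
  then show "LT (ext_ordering W \<delta> \<sigma>) (hom W \<delta> v) = incl_term (LT \<sigma> v)"
    using LT_rel(2) by (simp add: hom_eq_homogenize_to homogenize_to_def incl_term_def)
qed

text \<open>On terms of one degree the extended ordering is \<open>\<sigma>\<close> after removal of \<open>y\<close>. Without
  homogeneity this fails, and terms of \<open>V\<close> can even cancel: \<open>deh\<close> sends \<open>(y - 1) e\<^sub>i\<close> to \<open>0\<close>.\<close>

lemma
  fixes V :: "('n::finite option, 'k::comm_monoid_add) mpoly ^ 'r::finite"
  assumes tot: "strict_total \<sigma>" and V: "V \<noteq> 0" and h: "homogeneous (ext_weights W) \<delta> V"
  shows deh_nonzero: "deh V \<noteq> 0"
    and LT_deh: "LT \<sigma> (deh V) =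
      (deh_pp (fst (LT (ext_ordering W \<delta> \<sigma>) V)), snd (LT (ext_ordering W \<delta> \<sigma>) V))"
proof -
  have mono: "\<sigma> (deh_pp (fst S), snd S) (deh_pp (fst S'), snd S')"
    if "S \<in> mterms V" "S' \<in> mterms V" "ext_ordering W \<delta> \<sigma> S S'" for S S'
  proof -
    have "term_deg (ext_weights W) \<delta> S = term_deg (ext_weights W) \<delta> S'"
      using that h by (auto simp: homogeneous_def)
    then show ?thesis using that by (simp add: ext_ordering_def)
  qed
  note LT_rel = LT_relabel_vec[OF strict_total_ext_ordering[OF tot] tot V mono, folded deh_eq_relabel_vec]
  show "deh V \<noteq> 0" by (rule LT_rel(1))
  show "LT \<sigma> (deh V) =
      (deh_pp (fst (LT (ext_ordering W \<delta> \<sigma>) V)), snd (LT (ext_ordering W \<delta> \<sigma>) V))"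
    by (rule LT_rel(2))
qed

lemma
  fixes U :: "('n::finite option, 'k::comm_ring_1) mpoly ^ 'r::finite"
  assumes tot: "strict_total \<sigma>" and U: "U \<noteq> 0"
  shows y_power_mult_nonzero: "y_power m *s U \<noteq> 0"
    and LT_y_power_mult: "LT (ext_ordering W \<delta> \<sigma>) (y_power m *s U) =
      (Poly_Mapping.single None m + fst (LT (ext_ordering W \<delta> \<sigma>) U), snd (LT (ext_ordering W \<delta> \<sigma>) U))"
proof -
  have mono: "ext_ordering W \<delta> \<sigma> (Poly_Mapping.single None m + fst S, snd S)
      (Poly_Mapping.single None m + fst S', snd S')" if "ext_ordering W \<delta> \<sigma> S S'" for S S'
    using that by (simp add: ext_ordering_def term_deg_ext_weights lookup_add deh_pp_plus)
  note tot' = strict_total_ext_ordering[OF tot]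
  note LT_rel = LT_relabel_vec[OF tot' tot' U mono, folded y_power_mult_vec]
  show "y_power m *s U \<noteq> 0" by (rule LT_rel(1))
  show "LT (ext_ordering W \<delta> \<sigma>) (y_power m *s U) =
      (Poly_Mapping.single None m + fst (LT (ext_ordering W \<delta> \<sigma>) U), snd (LT (ext_ordering W \<delta> \<sigma>) U))"
    by (rule LT_rel(2))
qed


section \<open>Groebner bases and divisibility of leading terms\<close>

text \<open>In a module generated by terms, every term of every element is a multiple of a generator:
  the vectors with this property form a submodule, as neither sums nor multiples create terms
  that are not multiples of old ones.\<close>

lemma term_vec_in_span_iff:
  fixes A :: "('x, 'r::finite) mterm set"
  shows "(term_vec s :: ('x, 'k::comm_ring_1) mpoly ^ 'r) \<in> pmod.span (term_vec ` A) \<longleftrightarrow>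
    (\<exists>u\<in>A. \<exists>t. s = (t + fst u, snd u))"
    (is "?L \<longleftrightarrow> ?R")
proof
  let ?X = "{v :: ('x, 'k) mpoly ^ 'r. \<forall>s\<in>mterms v. \<exists>u\<in>A. \<exists>t. s = (t + fst u, snd u)}"
  have "pmod.span (term_vec ` A) \<subseteq> ?X"
  proof (rule pmod.span_minimal)
    show "term_vec ` A \<subseteq> ?X"
      by (force simp: mterms_def term_vec_def axis_def split: if_splits)
    show "pmod.subspace ?X"
    proof (rule pmod.subspaceI)
      show "0 \<in> ?X" by (simp add: mterms_def)
    next
      fix v w assume "v \<in> ?X" "w \<in> ?X"
      moreover have "mterms (v + w) \<subseteq> mterms v \<union> mterms w"
        using keys_add by (fastforce simp: mterms_def)
      ultimately show "v + w \<in> ?X" by blast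
    next
      fix p v assume v: "v \<in> ?X"
      have "\<exists>u\<in>A. \<exists>t. s = (t + fst u, snd u)" if s: "s \<in> mterms (p *s v)" for s
      proof -
        obtain t t' where t: "s = (t + t', snd s)" "(t', snd s) \<in> mterms v"
          using s keys_mult[of p "v $ snd s"] by (auto simp: mterms_def)
        with v obtain u t'' where u: "u \<in> A" "(t', snd s) = (t'' + fst u, snd u)" by blast
        with t have "s = ((t + t'') + fst u, snd u)" by (simp add: add.assoc)
        with u show ?thesis by blast
      qed
      then show "p *s v \<in> ?X" by blast
    qed
  qed
  moreover assume ?L
  moreover have "s \<in> mterms (term_vec s :: ('x, 'k) mpoly ^ 'r)"
    by (cases s) (simp add: mterms_def term_vec_def)
  ultimately show ?R by blast
next
  assume ?R
  then obtain u t where u: "u \<in> A" "s = (t + fst u, snd u)" by blast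
  have "(term_vec s :: ('x, 'k) mpoly ^ 'r) = Poly_Mapping.single t 1 *s term_vec u"
    by (simp add: u term_vec_def vec_eq_iff axis_def mult_single)
  then show ?L
    using u(1) by (simp only:) (intro pmod.span_scale pmod.span_base imageI)
qed

lemma groebner_basis_iff:
  fixes M G :: "(('x, 'k::field) mpoly ^ 'r::finite) set"
  shows "groebner_basis gt M G \<longleftrightarrow> G \<subseteq> M - {0} \<and>
    (\<forall>v\<in>M - {0}. \<exists>g\<in>G. \<exists>t. LT gt v = (t + fst (LT gt g), snd (LT gt g)))"
proof -
  let ?T = "term_vec :: ('x, 'r) mterm \<Rightarrow> ('x, 'k) mpoly ^ 'r"
  have "pmod.span (?T ` LT gt ` G) = pmod.span (?T ` LT gt ` (M - {0})) \<longleftrightarrow>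
      (\<forall>v\<in>M - {0}. ?T (LT gt v) \<in> pmod.span (?T ` LT gt ` G))" if "G \<subseteq> M - {0}"
  proof
    assume "pmod.span (?T ` LT gt ` G) = pmod.span (?T ` LT gt ` (M - {0}))"
    then show "\<forall>v\<in>M - {0}. ?T (LT gt v) \<in> pmod.span (?T ` LT gt ` G)"
      by (auto intro: pmod.span_base)
  next
    assume "\<forall>v\<in>M - {0}. ?T (LT gt v) \<in> pmod.span (?T ` LT gt ` G)"
    then show "pmod.span (?T ` LT gt ` G) = pmod.span (?T ` LT gt ` (M - {0}))"
      using that by (intro subset_antisym pmod.span_mono pmod.span_minimal) auto
  qed
  then show ?thesis
    unfolding groebner_basis_def term_vec_in_span_iff image_image[symmetric, of ?T "LT gt"] by auto
qed


section \<open>Leading terms and Groebner bases under homogenization\<close>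

theorem theorem27:
  fixes W :: "int ^ 'n::finite"
    and \<delta> :: "int ^ 'r::finite"
    and \<sigma> :: "('n, 'r) mterm \<Rightarrow> ('n, 'r) mterm \<Rightarrow> bool"
  assumes W_pos: "\<forall>j. 0 < W $ j"
    and \<sigma>: "module_ordering \<sigma>"
    and \<sigma>_deg: "degree_compatible W \<delta> \<sigma>"
  shows "(\<forall>v :: ('n, 'k::field) mpoly ^ 'r. v \<noteq> 0 \<longrightarrow>
            LT (ext_ordering W \<delta> \<sigma>) (hom W \<delta> v) = incl_term (LT \<sigma> v)) \<and>
         (\<forall>(N :: (('n option, 'k) mpoly ^ 'r) set) G.
            graded_submodule (ext_weights W) \<delta> N \<longrightarrow>
            finite G \<longrightarrow>
            (\<forall>V\<in>G. homogeneous (ext_weights W) \<delta> V) \<longrightarrow>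
            groebner_basis (ext_ordering W \<delta> \<sigma>) N G \<longrightarrow>
            groebner_basis (ext_ordering W \<delta> \<sigma>) (sat_module W \<delta> N) (sat W \<delta> ` G))"
proof (intro conjI allI impI)
  have tot: "strict_total \<sigma>" using \<sigma> by (simp add: module_ordering_def)
  show "LT (ext_ordering W \<delta> \<sigma>) (hom W \<delta> v) = incl_term (LT \<sigma> v)"
    if "v \<noteq> 0" for v :: "('n, 'k) mpoly ^ 'r"
    by (rule LT_hom[OF tot \<sigma>_deg that])
  fix N G :: "(('n option, 'k) mpoly ^ 'r) set"
  let ?LT = "LT (ext_ordering W \<delta> \<sigma>) :: ('n option, 'k) mpoly ^ 'r \<Rightarrow> _"
  assume N: "graded_submodule (ext_weights W) \<delta> N"
    and hom_G: "\<forall>V\<in>G. homogeneous (ext_weights W) \<delta> V"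
    and "groebner_basis (ext_ordering W \<delta> \<sigma>) N G"
  then have GN: "G \<subseteq> N - {0}" and div: "\<And>V. V \<in> N - {0} \<Longrightarrow>
      \<exists>g\<in>G. \<exists>t. ?LT V = (t + fst (?LT g), snd (?LT g))"
    by (auto simp: groebner_basis_iff)
  have LT_sat: "?LT (sat W \<delta> g) = (y_pp 0 (deh_pp (fst (?LT g))), snd (?LT g))"
    and sat_nonzero: "sat W \<delta> g \<noteq> 0" if "g \<in> G" for g
  proof -
    have g: "g \<noteq> 0" "homogeneous (ext_weights W) \<delta> g" using that GN hom_G by auto
    then show "sat W \<delta> g \<noteq> 0"
      unfolding sat_def by (intro hom_nonzero[OF tot \<sigma>_deg] deh_nonzero[OF tot])
    show "?LT (sat W \<delta> g) = (y_pp 0 (deh_pp (fst (?LT g))), snd (?LT g))"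
      unfolding sat_def LT_hom[OF tot \<sigma>_deg deh_nonzero[OF tot g]] LT_deh[OF tot g]
      by (simp add: incl_term_def)
  qed
  show "groebner_basis (ext_ordering W \<delta> \<sigma>) (sat_module W \<delta> N) (sat W \<delta> ` G)"
    unfolding groebner_basis_iff
  proof (intro conjI ballI)
    show "sat W \<delta> ` G \<subseteq> sat_module W \<delta> N - {0}"
      using GN sat_nonzero
      by (auto simp: sat_module_def hom_module_def sat_def intro!: pmod.span_base)
  next
    fix U assume "U \<in> sat_module W \<delta> N - {0}"
    then obtain m where "y_power m *s U \<in> N" and U: "U \<noteq> 0"
      using sat_module_y_power[OF N] by blast
    then obtain g t where g: "g \<in> G"
      and "?LT (y_power m *s U) = (t + fst (?LT g), snd (?LT g))"
      using div y_power_mult_nonzero[OF tot U] by blast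
    then have eq: "Poly_Mapping.single None m + fst (?LT U) = t + fst (?LT g)"
      and snd_eq: "snd (?LT U) = snd (?LT g)"
      by (simp_all add: LT_y_power_mult[OF tot U])
    (* The leading term of sat W \<delta> g is free of y, so the cofactor has to supply the whole power
       of y in the leading term of U; its other exponents are those of t. *)
    let ?t = "y_pp (Poly_Mapping.lookup (fst (?LT U)) None) (deh_pp t)"
    have "deh_pp (fst (?LT U)) = deh_pp t + deh_pp (fst (?LT g))"
      using arg_cong[OF eq, of deh_pp] by (simp add: deh_pp_plus)
    then have "fst (?LT U) = ?t + y_pp 0 (deh_pp (fst (?LT g)))"
      by (intro pp_option_eqI) (simp_all add: deh_pp_plus lookup_add)
    then have "?LT U = (?t + fst (?LT (sat W \<delta> g)), snd (?LT (sat W \<delta> g)))"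
      using snd_eq by (simp add: LT_sat[OF g] prod_eq_iff)
    with g show "\<exists>h\<in>sat W \<delta> ` G. \<exists>t. ?LT U = (t + fst (?LT h), snd (?LT h))"
      by blast
  qed
qed

end
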